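(* Let $X$ be a finite metric space and $k$ a positive integer. If $\mathrm{TC}(X)$ contains a linear subspace isometric to $\ell_\infty^k$, then the canonical graph $G(X,E)$ of $X$ contains vertices whose degrees are at least $2^{k-2}$. Furthermore, if $e_1,\dots,e_k\in \mathrm{TC}(X)$ are isometrically equivalent to the unit vector basis of $\ell_\infty^k$, then each vertex contained in the support $\{x\in X: e_i(x)\neq 0\}$ of any of the $e_i$, $i=1,\dots,k$, has degree at least $2^{k-2}$ in $G(X,E)$.
   Context: Let $(X,d)$ be a finite metric space. $\mathrm{TC}(X)$ is the real vector space of functions $f:X\to\mathbb{R}$ with $\sum_{v\in X} f(v)=0$, with the transportation cost norm $\|f\|_{\mathrm{TC}}=\inf \sum_{i=1}^n a_i d(x_i,y_i)$, the infimum over all representations $f=\sum_{i=1}^n a_i(\mathbf{1}_{x_i}-\mathbf{1}_{y_i})$ with $a_i\ge0$, $x_i,y_i\in X$, where $\mathbf 1_u$ is the indicator function of the point $u$. Canonical graph: take the complete graph on $X$ with edge $uv$ weighted by $d(u,v)$, and delete every edge $uv$ for which there is $w\notin\{u,v\}$ with $d(u,w)+d(w,v)=d(u,v)$. The result is the canonical graph $G(X,E)$. The degree of a vertex is the number of edges of $E$ incident to it. Vectors $e_1,\dots,e_k$ are isometrically equivalent to the unit vector basis of $\ell_\infty^k$ if $\|\sum_{i=1}^k a_ie_i\|_{\mathrm{TC}}=\max_i|a_i|$ for all real $a_1,\dots,a_k$. *)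

theory Defs
  imports "HOL-Analysis.Analysis" "HOL-Library.Function_Algebras"
begin

definition fun_scale :: "real \<Rightarrow> ('b \<Rightarrow> real) \<Rightarrow> 'b \<Rightarrow> real" where
  "fun_scale c f = (\<lambda>v. c * f v)"

interpretation fun_vs: vector_space fun_scale
  by unfold_locales (auto simp: fun_scale_def fun_eq_iff algebra_simps)

text \<open>A function on \<open>X\<close> is represented by its extension by zero to the whole type.\<close>

definition TC :: "'a set \<Rightarrow> ('a \<Rightarrow> real) set" where
  "TC X = {f. (\<forall>v. v \<notin> X \<longrightarrow> f v = 0) \<and> (\<Sum>v\<in>X. f v) = 0}"

text \<open>The infimum is a real one. It is only meaningful for \<open>f \<in> TC X\<close> with \<open>X\<close> a finite metric
  space, where the set of costs is nonempty and bounded below by zero.\<close>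

definition TC_norm :: "'a set \<Rightarrow> ('a \<Rightarrow> 'a \<Rightarrow> real) \<Rightarrow> ('a \<Rightarrow> real) \<Rightarrow> real" where
  "TC_norm X d f = Inf {\<Sum>i=1..n. a i * d (x i) (y i) | (n::nat) a x y.
     (\<forall>i\<in>{1..n}. 0 \<le> a i \<and> x i \<in> X \<and> y i \<in> X) \<and>
     f = (\<lambda>v. \<Sum>i=1..n. a i * (indicator {x i} v - indicator {y i} v))}"

definition canonical_edges :: "'a set \<Rightarrow> ('a \<Rightarrow> 'a \<Rightarrow> real) \<Rightarrow> 'a set set" where
  "canonical_edges X d = {{u, v} | u v. u \<in> X \<and> v \<in> X \<and> u \<noteq> v \<and>
     \<not> (\<exists>w\<in>X. w \<notin> {u, v} \<and> d u w + d w v = d u v)}"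

definition canonical_degree :: "'a set \<Rightarrow> ('a \<Rightarrow> 'a \<Rightarrow> real) \<Rightarrow> 'a \<Rightarrow> nat" where
  "canonical_degree X d v = card {e \<in> canonical_edges X d. v \<in> e}"

text \<open>The space \<open>\<ell>\<^sub>\<infinity>\<^sup>k\<close> for \<open>k \<ge> 1\<close>: its vectors are the real sequences supported on
  \<open>{1..k}\<close>. The norm only looks at the coordinates in \<open>{1..k}\<close>.\<close>

definition linf_space :: "nat \<Rightarrow> (nat \<Rightarrow> real) set" where
  "linf_space k = {a. \<forall>i. i \<notin> {1..k} \<longrightarrow> a i = 0}"

definition linf_norm :: "nat \<Rightarrow> (nat \<Rightarrow> real) \<Rightarrow> real" where
  "linf_norm k a = Max ((\<lambda>i. \<bar>a i\<bar>) ` {1..k})"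

text \<open>Isometric as normed spaces, i.e. through a linear isometry of \<open>\<ell>\<^sub>\<infinity>\<^sup>k\<close> onto \<open>L\<close>. Only the
  values of \<open>T\<close> on \<open>linf_space k\<close> matter: a linear map defined there extends to all sequences.\<close>

definition isometric_to_linf ::
    "'a set \<Rightarrow> ('a \<Rightarrow> 'a \<Rightarrow> real) \<Rightarrow> nat \<Rightarrow> ('a \<Rightarrow> real) set \<Rightarrow> bool" where
  "isometric_to_linf X d k L \<longleftrightarrow>
     (\<exists>T. Vector_Spaces.linear fun_scale fun_scale T \<and> bij_betw T (linf_space k) L \<and>
          (\<forall>a\<in>linf_space k. TC_norm X d (T a) = linf_norm k a))"

definition equiv_linf_basis ::
    "'a set \<Rightarrow> ('a \<Rightarrow> 'a \<Rightarrow> real) \<Rightarrow> nat \<Rightarrow> (nat \<Rightarrow> 'a \<Rightarrow> real) \<Rightarrow> bool" where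
  "equiv_linf_basis X d k e \<longleftrightarrow>
     (\<forall>a. TC_norm X d (\<Sum>i=1..k. fun_scale (a i) (e i)) = linf_norm k a)"

end

theory Submission
  imports Defs
begin

text \<open>
  For a sign vector \<open>\<theta>\<close> put \<open>f\<^sub>\<theta> = \<Sum>\<theta>\<^sub>j e\<^sub>j\<close>. Each \<open>f\<^sub>\<theta>\<close> has norm 1. If \<open>\<theta>\<close> and \<open>\<theta>'\<close> are neither
  equal nor opposite, then \<open>f\<^sub>\<theta> + f\<^sub>\<theta>'\<close> and \<open>f\<^sub>\<theta> - f\<^sub>\<theta>'\<close> both have norm 2, because some coordinate
  is doubled in each.

  A transport plan for a function in \<open>TC X\<close> can be regarded as an antisymmetric flow on the edges of
  the canonical graph whose divergence is that function: transport along a deleted edge \<open>uv\<close> is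
  rerouted through an intermediate point at no additional cost (\<open>canonical_unit_flow\<close>). The cost of
  a flow is a weighted \<open>\<ell>\<^sub>1\<close> norm. If \<open>F\<close> and \<open>G\<close> are flows of cost 1 such that both \<open>F + G\<close> and
  \<open>F - G\<close> cost at least 2, then there is no cancellation of either sign on any edge, so \<open>F\<close> and \<open>G\<close>
  use disjoint sets of edges. Hence the optimal flows of the \<open>2 ^ (k - 1)\<close> functions \<open>f\<^sub>\<theta>\<close>, taken
  up to sign, use pairwise disjoint sets of edges.

  Let \<open>e\<^sub>i(v) \<noteq> 0\<close> and normalise the signs by \<open>\<theta>\<^sub>i = 1\<close>. Changing all the other signs pairs the
  \<open>\<theta>\<close> in such a way that the two functions of a pair add up to \<open>2 e\<^sub>i\<close>, so at least one of them does
  not vanish at \<open>v\<close>. Thus at least half of the \<open>2 ^ (k - 1)\<close> flows use an edge at \<open>v\<close>, and these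
  edges are different.

  The formal argument replaces optimal flows by flows whose cost exceeds the norm by less than
  \<open>\<epsilon>\<close>, which exist by the definition of the infimum. Two of them may overlap, but only by
  \<open>O(\<epsilon>)\<close> (\<open>flow_overlap_le\<close>). On the other hand a flow whose divergence at \<open>v\<close> is nonzero carries
  at least a fixed amount along some edge at \<open>v\<close>. For small \<open>\<epsilon>\<close> the edges chosen in this way are
  therefore still different (\<open>card_le_canonical_degree\<close>).
\<close>

section \<open>Antisymmetric flows\<close>

text \<open>Antisymmetry makes \<open>F x y\<close> the signed amount carried by the undirected edge \<open>xy\<close>, so that
  transport in opposite directions cancels. This is what makes the disjointness of two flows a
  statement about undirected edges, the ones that the degree counts.\<close>

definition flow_on :: "'a set set \<Rightarrow> ('a \<Rightarrow> 'a \<Rightarrow> real) \<Rightarrow> bool" where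
  "flow_on E F \<longleftrightarrow> (\<forall>x y. F x y = - F y x) \<and> (\<forall>x y. F x y \<noteq> 0 \<longrightarrow> {x, y} \<in> E)"

definition net_flow :: "'a set \<Rightarrow> ('a \<Rightarrow> 'a \<Rightarrow> real) \<Rightarrow> 'a \<Rightarrow> real" where
  "net_flow X F v = (\<Sum>y\<in>X. F v y)"

text \<open>The factor \<open>1/2\<close> compensates for the two orientations of each edge.\<close>

definition flow_cost :: "'a set \<Rightarrow> ('a \<Rightarrow> 'a \<Rightarrow> real) \<Rightarrow> ('a \<Rightarrow> 'a \<Rightarrow> real) \<Rightarrow> real" where
  "flow_cost X d F = (\<Sum>x\<in>X. \<Sum>y\<in>X. \<bar>F x y\<bar> * d x y) / 2"

lemma flow_on_antisym: "flow_on E F \<Longrightarrow> F x y = - F y x"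
  unfolding flow_on_def by blast

lemma flow_on_edge: "flow_on E F \<Longrightarrow> F x y \<noteq> 0 \<Longrightarrow> {x, y} \<in> E"
  unfolding flow_on_def by blast

lemma flow_on_zero: "flow_on E (\<lambda>_ _. 0)"
  by (simp add: flow_on_def)

lemma flow_on_mono: "flow_on E F \<Longrightarrow> E \<subseteq> E' \<Longrightarrow> flow_on E' F"
  unfolding flow_on_def by blast

lemma flow_on_add: "flow_on E F \<Longrightarrow> flow_on E G \<Longrightarrow> flow_on E (\<lambda>x y. F x y + G x y)"
  unfolding flow_on_def by (metis add.left_neutral add_eq_0_iff minus_add_distrib)

lemma flow_on_scale: "flow_on E F \<Longrightarrow> flow_on E (\<lambda>x y. c * F x y)"
  unfolding flow_on_def by (metis mult_minus_right mult_zero_right)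

lemma flow_on_diff: "flow_on E F \<Longrightarrow> flow_on E G \<Longrightarrow> flow_on E (\<lambda>x y. F x y - G x y)"
  using flow_on_add[of E F "\<lambda>x y. (-1) * G x y"] flow_on_scale[of E G "-1"] by simp

lemma flow_on_sum:
  "(\<And>i. i \<in> I \<Longrightarrow> flow_on E (F i)) \<Longrightarrow> flow_on E (\<lambda>x y. \<Sum>i\<in>I. F i x y)"
proof (induction I rule: infinite_finite_induct)
  case (insert i I)
  then show ?case using flow_on_add[of E "F i" "\<lambda>x y. \<Sum>i\<in>I. F i x y"] by simp
qed (simp_all add: flow_on_zero)

lemma net_flow_add: "net_flow X (\<lambda>x y. F x y + G x y) v = net_flow X F v + net_flow X G v"
  by (simp add: net_flow_def sum.distrib)

lemma net_flow_diff: "net_flow X (\<lambda>x y. F x y - G x y) v = net_flow X F v - net_flow X G v"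
  by (simp add: net_flow_def sum_subtractf)

lemma net_flow_weighted_sum:
  "net_flow X (\<lambda>x y. \<Sum>i\<in>I. a i * F i x y) v = (\<Sum>i\<in>I. a i * net_flow X (F i) v)"
  unfolding net_flow_def by (subst sum.swap) (simp add: sum_distrib_left)

section \<open>Auxiliary facts about sums, sets and norms\<close>

lemma sum_fun_apply: "(\<Sum>i\<in>I. f i) x = (\<Sum>i\<in>I. f i x)"
  by (induction I rule: infinite_finite_induct) simp_all

lemma linf_norm_eqI:
  assumes "i \<in> {1..k}" and "\<bar>a i\<bar> = c" and "\<And>j. j \<in> {1..k} \<Longrightarrow> \<bar>a j\<bar> \<le> c"
  shows "linf_norm k a = c"
  unfolding linf_norm_def using assms by (intro Max_eqI) auto

text \<open>Complementation maps the sets violating \<open>P\<close> injectively to sets satisfying it.\<close>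

lemma half_card_le:
  assumes "finite I" and "\<And>S. S \<subseteq> I \<Longrightarrow> P S \<or> P (I - S)"
  shows "2 ^ card I \<le> 2 * card {S. S \<subseteq> I \<and> P S}"
proof -
  let ?N = "{S. S \<subseteq> I \<and> P S}"
  have fin: "finite ?N" using assms(1) by simp
  have "Pow I \<subseteq> ?N \<union> (\<lambda>S. I - S) ` ?N"
  proof
    fix S assume "S \<in> Pow I"
    then have "S \<subseteq> I" "S = I - (I - S)" by auto
    then show "S \<in> ?N \<union> (\<lambda>S. I - S) ` ?N" using assms(2) by blast
  qed
  then have "card (Pow I) \<le> card (?N \<union> (\<lambda>S. I - S) ` ?N)"
    using fin by (intro card_mono) auto
  also have "\<dots> \<le> card ?N + card ((\<lambda>S. I - S) ` ?N)" by (rule card_Un_le)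
  also have "\<dots> \<le> 2 * card ?N" using card_image_le[OF fin, of "\<lambda>S. I - S"] by simp
  finally show ?thesis using assms(1) by (simp add: card_Pow)
qed

section \<open>Flows and the transportation cost norm\<close>

locale finite_metric = Metric_space X d for X :: "'a set" and d +
  assumes finite_X: "finite X"
begin

lemma flow_cost_add:
  "flow_cost X d (\<lambda>x y. F x y + G x y) \<le> flow_cost X d F + flow_cost X d G"
proof -
  have "(\<Sum>x\<in>X. \<Sum>y\<in>X. \<bar>F x y + G x y\<bar> * d x y)
      \<le> (\<Sum>x\<in>X. \<Sum>y\<in>X. \<bar>F x y\<bar> * d x y + \<bar>G x y\<bar> * d x y)"
    by (intro sum_mono) (metis abs_triangle_ineq distrib_right mult_right_mono nonneg)
  then show ?thesis by (simp add: flow_cost_def sum.distrib)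
qed

lemma flow_cost_weighted_sum:
  assumes "finite I" and "\<And>i. i \<in> I \<Longrightarrow> 0 \<le> a i"
  shows "flow_cost X d (\<lambda>x y. \<Sum>i\<in>I. a i * F i x y) \<le> (\<Sum>i\<in>I. a i * flow_cost X d (F i))"
  using assms
proof (induction I)
  case empty
  then show ?case by (simp add: flow_cost_def)
next
  case (insert i I)
  have "flow_cost X d (\<lambda>x y. a i * F i x y) = a i * flow_cost X d (F i)"
    using insert.prems[of i] by (simp add: flow_cost_def abs_mult sum_distrib_left mult.assoc)
  then show ?case
    using insert flow_cost_add[of "\<lambda>x y. a i * F i x y" "\<lambda>x y. \<Sum>i\<in>I. a i * F i x y"] by simp
qed

definition transport_costs :: "('a \<Rightarrow> real) \<Rightarrow> real set" where
  "transport_costs f = {\<Sum>i=1..n. a i * d (x i) (y i) | (n::nat) a x y.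
     (\<forall>i\<in>{1..n}. 0 \<le> a i \<and> x i \<in> X \<and> y i \<in> X) \<and>
     f = (\<lambda>v. \<Sum>i=1..n. a i * (indicator {x i} v - indicator {y i} v))}"

lemma TC_norm_eq_Inf: "TC_norm X d f = Inf (transport_costs f)"
  unfolding TC_norm_def transport_costs_def ..

lemma transport_costs_nonneg: "c \<in> transport_costs f \<Longrightarrow> 0 \<le> c"
  unfolding transport_costs_def by (auto intro!: sum_nonneg)

text \<open>The plan that realises the cost sends the positive part of \<open>F x y\<close> from \<open>x\<close> to \<open>y\<close>, for all
  ordered pairs. By antisymmetry the positive parts for the two orientations differ by \<open>F x y\<close> and
  add up to its absolute value.\<close>

lemma flow_cost_in_transport_costs:
  assumes "flow_on (Pow X) F"
  shows "flow_cost X d F \<in> transport_costs (net_flow X F)"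
proof -
  have supp: "x \<in> X \<and> y \<in> X" if "F x y \<noteq> 0" for x y
    using flow_on_edge[OF assms that] by simp
  define P where "P x y = max (F x y) 0" for x y
  have P: "P x y - P y x = F x y" "P x y + P y x = \<bar>F x y\<bar>" for x y
    unfolding P_def flow_on_antisym[OF assms, of y x] by auto
  define n where "n = card (X \<times> X)"
  obtain h where h: "bij_betw h {1..n} (X \<times> X)"
    unfolding n_def using ex_bij_betw_nat_finite_1[OF finite_cartesian_product[OF finite_X finite_X]] by blast
  have reidx: "(\<Sum>i=1..n. g (fst (h i)) (snd (h i))) = (\<Sum>x\<in>X. \<Sum>y\<in>X. g x y)" 
    for g :: "'a \<Rightarrow> 'a \<Rightarrow> real"
    using sum.reindex_bij_betw[OF h, of "\<lambda>p. g (fst p) (snd p)"]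
    by (simp add: sum.cartesian_product case_prod_beta)
  have in_X: "fst (h i) \<in> X \<and> snd (h i) \<in> X" if "i \<in> {1..n}" for i
    using bij_betwE[OF h] that by (auto simp: mem_Times_iff)
  have "(\<Sum>x\<in>X. \<Sum>y\<in>X. P x y * d x y) = (\<Sum>x\<in>X. \<Sum>y\<in>X. P y x * d x y)"
    by (subst sum.swap) (simp add: commute)
  then have "2 * (\<Sum>x\<in>X. \<Sum>y\<in>X. P x y * d x y) = (\<Sum>x\<in>X. \<Sum>y\<in>X. \<bar>F x y\<bar> * d x y)"
    by (simp add: P(2)[symmetric] distrib_right sum.distrib)
  then have cost: "flow_cost X d F = (\<Sum>i=1..n. P (fst (h i)) (snd (h i)) * d (fst (h i)) (snd (h i)))"
    using reidx[of "\<lambda>x y. P x y * d x y"] by (simp add: flow_cost_def)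
  have net: "net_flow X F v = (\<Sum>i=1..n. P (fst (h i)) (snd (h i)) *
       (indicator {fst (h i)} v - indicator {snd (h i)} v))" for v
  proof -
    have "(\<Sum>x\<in>X. \<Sum>y\<in>X. P x y * (indicator {x} v - indicator {y} v))
       = (\<Sum>x\<in>X. \<Sum>y\<in>X. P x y * indicator {x} v) - (\<Sum>x\<in>X. \<Sum>y\<in>X. P x y * indicator {y} v)"
      by (simp add: right_diff_distrib sum_subtractf)
    also have "(\<Sum>x\<in>X. \<Sum>y\<in>X. P x y * indicator {x} v) = (if v \<in> X then \<Sum>y\<in>X. P v y else 0)"
      by (subst sum.swap) (simp add: indicator_def finite_X)
    also have "(\<Sum>x\<in>X. \<Sum>y\<in>X. P x y * indicator {y} v) = (if v \<in> X then \<Sum>y\<in>X. P y v else 0)"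
      by (simp add: indicator_def finite_X)
    also have "(if v \<in> X then \<Sum>y\<in>X. P v y else 0) - (if v \<in> X then \<Sum>y\<in>X. P y v else 0)
       = (if v \<in> X then net_flow X F v else 0)"
      by (simp add: net_flow_def sum_subtractf[symmetric] P)
    also have "\<dots> = net_flow X F v"
      using supp by (auto simp: net_flow_def intro!: sum.neutral)
    finally show ?thesis
      by (simp only: reidx[of "\<lambda>x y. P x y * (indicator {x} v - indicator {y} v)"])
  qed
  show ?thesis
    unfolding transport_costs_def mem_Collect_eq cost
    by (rule exI[of _ n], rule exI[of _ "\<lambda>i. P (fst (h i)) (snd (h i))"],
      rule exI[of _ "\<lambda>i. fst (h i)"], rule exI[of _ "\<lambda>i. snd (h i)"])
      (use in_X net in \<open>simp add: fun_eq_iff P_def\<close>)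
qed

lemma TC_norm_le_flow_cost:
  assumes "flow_on (Pow X) F"
  shows "TC_norm X d (net_flow X F) \<le> flow_cost X d F"
  unfolding TC_norm_eq_Inf
  by (intro cInf_lower flow_cost_in_transport_costs assms bdd_belowI[of _ 0] transport_costs_nonneg)

lemma transport_costs_nonempty:
  assumes "f \<in> TC X"
  shows "transport_costs f \<noteq> {}"
proof -
  \<comment> \<open>Sending \<open>(f x - f y) / card X\<close> between all pairs has divergence \<open>f\<close>, since \<open>f\<close> has mean zero.\<close>
  define F where "F x y = (if x \<in> X \<and> y \<in> X then (f x - f y) / card X else 0)" for x y
  have "flow_on (Pow X) F"
    by (auto simp: flow_on_def F_def minus_divide_left)
  moreover have "net_flow X F v = f v" for v
    using assms finite_X
    by (cases "v \<in> X") (auto simp: net_flow_def F_def TC_def sum_subtractf sum_divide_distrib[symmetric])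
  ultimately show ?thesis
    using flow_cost_in_transport_costs[of F] by (metis empty_iff ext)
qed

lemma canonical_edges_subset: "canonical_edges X d \<subseteq> Pow X"
  by (auto simp: canonical_edges_def)

text \<open>If \<open>uv\<close> is not an edge, a point \<open>w\<close> between \<open>u\<close> and \<open>v\<close> splits the transport into two
  transports over strictly smaller distances, and the costs add up exactly. As there are finitely
  many distances, the splitting ends.\<close>

lemma canonical_unit_flow:
  assumes "u \<in> X" and "v \<in> X"
  shows "\<exists>F. flow_on (canonical_edges X d) F \<and> flow_cost X d F \<le> d u v \<and>
             (\<forall>z. net_flow X F z = indicator {u} z - indicator {v} z)"
  using assms
proof (induction "card {p \<in> X \<times> X. d (fst p) (snd p) < d u v}" arbitrary: u v rule: less_induct)
  case less
  consider "u = v" | "u \<noteq> v" "{u, v} \<in> canonical_edges X d"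
    | w where "w \<in> X" "w \<noteq> u" "w \<noteq> v" "d u w + d w v = d u v"
    using less.prems unfolding canonical_edges_def by blast
  then show ?case
  proof cases
    case 1
    show ?thesis
      by (rule exI[of _ "\<lambda>_ _. 0"]) (simp add: 1 flow_on_zero flow_cost_def net_flow_def)
  next
    case 2
    define F :: "'a \<Rightarrow> 'a \<Rightarrow> real" where
      "F x y = indicator {u} x * indicator {v} y - indicator {v} x * indicator {u} y" for x y
    have "flow_on (canonical_edges X d) F"
      using 2 by (auto simp: flow_on_def F_def indicator_def insert_commute)
    moreover have "net_flow X F z = indicator {u} z - indicator {v} z" for z
      using less.prems finite_X
      by (simp add: net_flow_def F_def sum_subtractf sum_distrib_left[symmetric] indicator_def)
    moreover have "flow_cost X d F \<le> d u v"
    proof -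
      have "\<bar>F x y\<bar> * d x y = indicator {u} x * (indicator {v} y * d x y) +
              indicator {v} x * (indicator {u} y * d x y)" for x y
        using 2(1) by (auto simp: F_def indicator_def)
      then have "flow_cost X d F = (d u v + d v u) / 2"
        using less.prems finite_X
        by (simp add: flow_cost_def sum.distrib sum_distrib_left[symmetric] indicator_def)
      then show ?thesis by (simp add: commute)
    qed
    ultimately show ?thesis by blast
  next
    case (3 w)
    have pos: "0 < d u w" "0 < d w v"
      using 3 less.prems by auto
    have shorter: "\<exists>F. flow_on (canonical_edges X d) F \<and> flow_cost X d F \<le> d x y \<and>
             (\<forall>z. net_flow X F z = indicator {x} z - indicator {y} z)"
      if "x \<in> X" "y \<in> X" "d x y < d u v" for x y
    proof (rule less.hyps)
      show "card {p \<in> X \<times> X. d (fst p) (snd p) < d x y} < card {p \<in> X \<times> X. d (fst p) (snd p) < d u v}"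
      proof (intro psubset_card_mono psubsetI notI)
        assume "{p \<in> X \<times> X. d (fst p) (snd p) < d x y} = {p \<in> X \<times> X. d (fst p) (snd p) < d u v}"
        then show False using that by (auto dest: equalityD2[THEN subsetD, of _ _ "(x, y)"])
      qed (use that finite_X in auto)
    qed (use that in auto)
    obtain F G where F: "flow_on (canonical_edges X d) F" "flow_cost X d F \<le> d u w"
        "\<And>z. net_flow X F z = indicator {u} z - indicator {w} z"
      and G: "flow_on (canonical_edges X d) G" "flow_cost X d G \<le> d w v"
        "\<And>z. net_flow X G z = indicator {w} z - indicator {v} z"
      using shorter[of u w] shorter[of w v] pos 3 less.prems by auto
    show ?thesis
      using flow_on_add[OF F(1) G(1)] flow_cost_add[of F G] F(2,3) G(2,3) 3(4)
      by (intro exI[of _ "\<lambda>x y. F x y + G x y"]) (simp add: net_flow_add)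
  qed
qed

text \<open>Replacing every unit transport of a nearly optimal plan by its canonical flow does not raise
  the cost.\<close>

lemma near_optimal_canonical_flow:
  assumes "f \<in> TC X" and "0 < \<epsilon>"
  shows "\<exists>F. flow_on (canonical_edges X d) F \<and> net_flow X F = f \<and>
             flow_cost X d F < TC_norm X d f + \<epsilon>"
proof -
  obtain c where "c \<in> transport_costs f" and less: "c < TC_norm X d f + \<epsilon>"
    using cInf_lessD[OF transport_costs_nonempty[OF assms(1)], of "TC_norm X d f + \<epsilon>"] assms(2)
    unfolding TC_norm_eq_Inf by auto
  then obtain n :: nat and a x y where c: "c = (\<Sum>i=1..n. a i * d (x i) (y i))"
    and axy: "\<And>i. i \<in> {1..n} \<Longrightarrow> 0 \<le> a i \<and> x i \<in> X \<and> y i \<in> X"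
    and f: "f = (\<lambda>v. \<Sum>i=1..n. a i * (indicator {x i} v - indicator {y i} v))"
    unfolding transport_costs_def by blast
  have "\<forall>i\<in>{1..n}. \<exists>F. flow_on (canonical_edges X d) F \<and> flow_cost X d F \<le> d (x i) (y i) \<and>
             (\<forall>z. net_flow X F z = indicator {x i} z - indicator {y i} z)"
    using canonical_unit_flow axy by blast
  then obtain F where F: "\<And>i. i \<in> {1..n} \<Longrightarrow> flow_on (canonical_edges X d) (F i)"
      "\<And>i. i \<in> {1..n} \<Longrightarrow> flow_cost X d (F i) \<le> d (x i) (y i)"
      "\<And>i z. i \<in> {1..n} \<Longrightarrow> net_flow X (F i) z = indicator {x i} z - indicator {y i} z"
    by metis
  define G where "G x y = (\<Sum>i=1..n. a i * F i x y)" for x y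
  have "flow_on (canonical_edges X d) G"
    unfolding G_def by (intro flow_on_sum flow_on_scale F(1))
  moreover have "net_flow X G = f"
    unfolding G_def f by (rule ext) (simp only: net_flow_weighted_sum F(3) cong: sum.cong)
  moreover have "flow_cost X d G \<le> c"
  proof -
    have "flow_cost X d G \<le> (\<Sum>i=1..n. a i * flow_cost X d (F i))"
      unfolding G_def by (rule flow_cost_weighted_sum) (use axy in auto)
    also have "\<dots> \<le> c"
      unfolding c by (intro sum_mono mult_left_mono F(2)) (use axy in auto)
    finally show ?thesis .
  qed
  ultimately show ?thesis using less by force
qed

section \<open>Flows whose sum and difference are expensive\<close>

text \<open>Since \<open>\<bar>a + b\<bar> + \<bar>a - b\<bar> = 2 * max \<bar>a\<bar> \<bar>b\<bar>\<close>, the costs of \<open>F + G\<close> and \<open>F - G\<close> together fall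
  short of \<open>2 * (cost F + cost G)\<close> exactly by the weighted overlap of \<open>F\<close> and \<open>G\<close>, summed over
  ordered pairs. The hypotheses bound this deficit by \<open>2 * \<epsilon>\<close>.\<close>

lemma flow_overlap_le:
  assumes F: "flow_on (Pow X) F" and G: "flow_on (Pow X) G" and "x \<in> X" and "y \<in> X"
    and plus: "flow_cost X d F + flow_cost X d G
           \<le> TC_norm X d (\<lambda>v. net_flow X F v + net_flow X G v) + \<epsilon>"
    and minus: "flow_cost X d F + flow_cost X d G
           \<le> TC_norm X d (\<lambda>v. net_flow X F v - net_flow X G v) + \<epsilon>"
  shows "min \<bar>F x y\<bar> \<bar>G x y\<bar> * d x y \<le> 2 * \<epsilon>"
proof -
  define m where "m x y = min \<bar>F x y\<bar> \<bar>G x y\<bar> * d x y" for x y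
  have "TC_norm X d (\<lambda>v. net_flow X F v + net_flow X G v) \<le> flow_cost X d (\<lambda>x y. F x y + G x y)"
    using TC_norm_le_flow_cost[OF flow_on_add[OF F G]] by (simp add: net_flow_add[abs_def])
  moreover have "TC_norm X d (\<lambda>v. net_flow X F v - net_flow X G v)
      \<le> flow_cost X d (\<lambda>x y. F x y - G x y)"
    using TC_norm_le_flow_cost[OF flow_on_diff[OF F G]] by (simp add: net_flow_diff[abs_def])
  moreover have "flow_cost X d (\<lambda>x y. F x y + G x y) + flow_cost X d (\<lambda>x y. F x y - G x y)
      + (\<Sum>x\<in>X. \<Sum>y\<in>X. m x y) = 2 * (flow_cost X d F + flow_cost X d G)"
  proof -
    have "\<bar>F x y + G x y\<bar> + \<bar>F x y - G x y\<bar> + 2 * min \<bar>F x y\<bar> \<bar>G x y\<bar> = 2 * (\<bar>F x y\<bar> + \<bar>G x y\<bar>)" for x y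
      by (auto simp: min_def abs_if)
    then have "\<bar>F x y + G x y\<bar> * d x y + \<bar>F x y - G x y\<bar> * d x y + 2 * m x y
        = 2 * (\<bar>F x y\<bar> * d x y + \<bar>G x y\<bar> * d x y)" for x y
      unfolding m_def by (metis distrib_right mult.assoc)
    then have "(\<Sum>x\<in>X. \<Sum>y\<in>X. \<bar>F x y + G x y\<bar> * d x y + \<bar>F x y - G x y\<bar> * d x y + 2 * m x y)
        = (\<Sum>x\<in>X. \<Sum>y\<in>X. 2 * (\<bar>F x y\<bar> * d x y + \<bar>G x y\<bar> * d x y))"
      by simp
    then show ?thesis
      by (simp add: flow_cost_def sum.distrib sum_distrib_left[symmetric])
  qed
  ultimately have "(\<Sum>x\<in>X. \<Sum>y\<in>X. m x y) \<le> 2 * \<epsilon>"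
    using plus minus by argo
  moreover have "m x y \<le> (\<Sum>x\<in>X. \<Sum>y\<in>X. m x y)"
  proof -
    have "m x y \<le> (\<Sum>y\<in>X. m x y)"
      by (rule member_le_sum) (use assms finite_X in \<open>auto simp: m_def\<close>)
    also have "\<dots> \<le> (\<Sum>x\<in>X. \<Sum>y\<in>X. m x y)"
      by (rule member_le_sum[of x X "\<lambda>x. \<Sum>y\<in>X. m x y"])
        (use assms finite_X in \<open>auto simp: m_def intro!: sum_nonneg\<close>)
    finally show ?thesis .
  qed
  ultimately show ?thesis by (simp add: m_def)
qed

text \<open>Each \<open>g S\<close> is given an edge at \<open>v\<close> on which its nearly optimal flow is at least \<open>\<delta> / card X\<close>,
  where \<open>\<delta>\<close> bounds all \<open>\<bar>g S v\<bar>\<close> from below. A common edge for two indices would make the overlap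
  of the two flows too large.\<close>

lemma card_le_canonical_degree:
  assumes "finite N" and TC: "\<And>S. S \<in> N \<Longrightarrow> g S \<in> TC X" and nz: "\<And>S. S \<in> N \<Longrightarrow> g S v \<noteq> 0"
    and norm: "\<And>S. S \<in> N \<Longrightarrow> TC_norm X d (g S) = 1"
    and plus: "\<And>S T. S \<in> N \<Longrightarrow> T \<in> N \<Longrightarrow> S \<noteq> T \<Longrightarrow> TC_norm X d (\<lambda>x. g S x + g T x) = 2"
    and minus: "\<And>S T. S \<in> N \<Longrightarrow> T \<in> N \<Longrightarrow> S \<noteq> T \<Longrightarrow> TC_norm X d (\<lambda>x. g S x - g T x) = 2"
    and v: "v \<in> X"
  shows "card N \<le> canonical_degree X d v"
proof -
  have n: "0 < card X" using v finite_X card_gt_0_iff by blast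
  obtain \<delta> where \<delta>: "0 < \<delta>" "\<And>S. S \<in> N \<Longrightarrow> \<delta> \<le> \<bar>g S v\<bar>"
  proof
    show "0 < Min (insert 1 ((\<lambda>S. \<bar>g S v\<bar>) ` N))"
      using assms(1) nz by simp
  qed (use assms(1) in auto)
  obtain \<mu> where \<mu>: "0 < \<mu>" "\<And>y. y \<in> X \<Longrightarrow> y \<noteq> v \<Longrightarrow> \<mu> \<le> d v y"
  proof
    show "0 < Min (insert 1 (d v ` (X - {v})))"
      using finite_X v by auto
  qed (use finite_X in auto)
  \<comment> \<open>Flows of cost less than \<open>1 + \<epsilon>\<close> overlap by at most \<open>4 * \<epsilon>\<close>, while a shared edge would give an
    overlap of at least \<open>\<delta> / card X * \<mu> = 8 * \<epsilon>\<close>.\<close>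
  define \<epsilon> where "\<epsilon> = \<delta> / card X * \<mu> / 8"
  have \<epsilon>: "0 < \<epsilon>" using \<delta>(1) \<mu>(1) n by (simp add: \<epsilon>_def)
  have "\<forall>S\<in>N. \<exists>F. flow_on (canonical_edges X d) F \<and> net_flow X F = g S \<and> flow_cost X d F < 1 + \<epsilon>"
    using near_optimal_canonical_flow[OF TC \<epsilon>] norm by metis
  then obtain F where F: "\<And>S. S \<in> N \<Longrightarrow> flow_on (canonical_edges X d) (F S)"
      "\<And>S. S \<in> N \<Longrightarrow> net_flow X (F S) = g S" "\<And>S. S \<in> N \<Longrightarrow> flow_cost X d (F S) < 1 + \<epsilon>"
    by metis
  have "\<forall>S\<in>N. \<exists>y\<in>X. \<delta> / card X \<le> \<bar>F S v y\<bar>"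
  proof (intro ballI, rule ccontr)
    fix S assume S: "S \<in> N" and "\<not> (\<exists>y\<in>X. \<delta> / card X \<le> \<bar>F S v y\<bar>)"
    then have "(\<Sum>y\<in>X. \<bar>F S v y\<bar>) < (\<Sum>y\<in>X. \<delta> / card X)"
      using v finite_X by (intro sum_strict_mono) auto
    then have "\<bar>g S v\<bar> < \<delta>"
      using n le_less_trans[OF sum_abs[of "\<lambda>y. F S v y" X]] by (simp add: net_flow_def flip: F(2)[OF S])
    then show False using \<delta>(2)[OF S] by simp
  qed
  then obtain y where y: "\<And>S. S \<in> N \<Longrightarrow> y S \<in> X" "\<And>S. S \<in> N \<Longrightarrow> \<delta> / card X \<le> \<bar>F S v (y S)\<bar>"
    by metis
  have edge: "{v, y S} \<in> canonical_edges X d" if "S \<in> N" for S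
  proof -
    have "F S v (y S) \<noteq> 0" using y(2)[OF that] \<delta>(1) n by (auto simp: divide_le_0_iff)
    then show ?thesis by (rule flow_on_edge[OF F(1)[OF that]])
  qed
  have "inj_on (\<lambda>S. {v, y S}) N"
  proof (rule inj_onI, rule ccontr)
    fix S T assume ST: "S \<in> N" "T \<in> N" "S \<noteq> T" and eq: "{v, y S} = {v, y T}"
    then have yy: "y S = y T" by (metis doubleton_eq_iff)
    have "y S \<noteq> v"
      using edge[OF ST(1)] by (auto simp: canonical_edges_def doubleton_eq_iff)
    then have "\<mu> \<le> d v (y S)" using \<mu>(2) y(1) ST by blast
    moreover have "\<delta> / card X \<le> min \<bar>F S v (y S)\<bar> \<bar>F T v (y S)\<bar>"
      using y(2)[OF ST(1)] y(2)[OF ST(2)] yy by simp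
    ultimately have "\<delta> / card X * \<mu> \<le> min \<bar>F S v (y S)\<bar> \<bar>F T v (y S)\<bar> * d v (y S)"
      using \<mu>(1) by (intro mult_mono) auto
    also have "\<dots> \<le> 2 * (2 * \<epsilon>)"
    proof (rule flow_overlap_le)
      show "flow_on (Pow X) (F S)" "flow_on (Pow X) (F T)"
        using F(1) ST canonical_edges_subset flow_on_mono by blast+
      show "flow_cost X d (F S) + flow_cost X d (F T)
          \<le> TC_norm X d (\<lambda>v. net_flow X (F S) v + net_flow X (F T) v) + 2 * \<epsilon>"
        "flow_cost X d (F S) + flow_cost X d (F T)
          \<le> TC_norm X d (\<lambda>v. net_flow X (F S) v - net_flow X (F T) v) + 2 * \<epsilon>"
        using F(3)[OF ST(1)] F(3)[OF ST(2)] plus[OF ST] minus[OF ST] ST by (simp_all add: F(2))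
    qed (use v y ST in auto)
    also have "\<dots> < 8 * \<epsilon>" using \<epsilon> by simp
    finally show False by (simp add: \<epsilon>_def)
  qed
  then have "card N = card ((\<lambda>S. {v, y S}) ` N)" by (simp add: card_image)
  also have "\<dots> \<le> canonical_degree X d v"
    unfolding canonical_degree_def
  proof (rule card_mono)
    show "finite {e \<in> canonical_edges X d. v \<in> e}"
      using canonical_edges_subset finite_X by (auto intro: finite_subset)
  qed (use edge in auto)
  finally show ?thesis .
qed

section \<open>Degrees of the support points of a basis\<close>

text \<open>Sign vectors with \<open>\<theta>\<^sub>i = 1\<close> are encoded by the set \<open>S\<close> of the indices with sign \<open>-1\<close>, a
  subset of \<open>{1..k} - {i}\<close>. This selects one vector from each pair of opposite ones, and changing all
  signs other than the \<open>i\<close>-th becomes complementation.\<close>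

lemma support_degree:
  assumes TC: "\<And>j. j \<in> {1..k} \<Longrightarrow> e j \<in> TC X" and eqv: "equiv_linf_basis X d k e"
    and i: "i \<in> {1..k}" and v: "v \<in> X" and nz: "e i v \<noteq> 0"
  shows "2 powi (int k - 2) \<le> real (canonical_degree X d v)"
proof -
  have norm: "TC_norm X d (\<lambda>x. \<Sum>j=1..k. a j * e j x) = linf_norm k a" for a
  proof -
    have "(\<Sum>j=1..k. fun_scale (a j) (e j)) = (\<lambda>x. \<Sum>j=1..k. a j * e j x)"
      by (rule ext) (simp add: sum_fun_apply fun_scale_def)
    then show ?thesis using eqv unfolding equiv_linf_basis_def by metis
  qed
  define I where "I = {1..k} - {i}"
  define s :: "nat set \<Rightarrow> nat \<Rightarrow> real" where "s S j = (if j \<in> S then -1 else 1)" for S j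
  define g where "g S x = (\<Sum>j=1..k. s S j * e j x)" for S x
  define N where "N = {S. S \<subseteq> I \<and> g S v \<noteq> 0}"
  have "g S v + g (I - S) v = 2 * e i v" if "S \<subseteq> I" for S
  proof -
    have "g S v + g (I - S) v = (\<Sum>j=1..k. if j = i then 2 * e i v else 0)"
      unfolding g_def sum.distrib[symmetric] using that
      by (intro sum.cong refl) (auto simp: s_def I_def)
    then show ?thesis using i by simp
  qed
  then have "g S v \<noteq> 0 \<or> g (I - S) v \<noteq> 0" if "S \<subseteq> I" for S
    using nz that by (metis add.right_neutral mult_eq_0_iff zero_neq_numeral)
  then have "2 ^ card I \<le> 2 * card N"
    unfolding N_def by (intro half_card_le) (auto simp: I_def)
  moreover have "card N \<le> canonical_degree X d v"
  proof (rule card_le_canonical_degree[where g = g])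
    show "finite N" unfolding N_def I_def by simp
    fix S assume S: "S \<in> N"
    show "g S v \<noteq> 0" using S by (simp add: N_def)
    have "(\<Sum>x\<in>X. g S x) = (\<Sum>j=1..k. s S j * (\<Sum>x\<in>X. e j x))"
      unfolding g_def by (subst sum.swap) (simp add: sum_distrib_left)
    then show "g S \<in> TC X"
      using TC by (auto simp: TC_def g_def)
    show "TC_norm X d (g S) = 1"
      unfolding g_def norm by (rule linf_norm_eqI[OF i]) (auto simp: s_def)
    fix T assume T: "T \<in> N" and ne: "S \<noteq> T"
    have sub: "S \<subseteq> I" "T \<subseteq> I" using S T by (auto simp: N_def)
    \<comment> \<open>The signs agree at \<open>i\<close>, so the sum has a coefficient 2 there.\<close>
    have "(\<lambda>x. g S x + g T x) = (\<lambda>x. \<Sum>j=1..k. (s S j + s T j) * e j x)"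
      by (simp add: g_def sum.distrib distrib_right)
    then show "TC_norm X d (\<lambda>x. g S x + g T x) = 2"
      using sub by (simp only: norm) (rule linf_norm_eqI[OF i], auto simp: s_def I_def)
    \<comment> \<open>The signs differ at some \<open>j\<close>, so the difference has a coefficient of modulus 2 there.\<close>
    have "\<exists>j\<in>I. j \<in> S \<longleftrightarrow> j \<notin> T"
      using ne sub by blast
    then obtain j where j: "j \<in> {1..k}" "j \<in> S \<longleftrightarrow> j \<notin> T"
      unfolding I_def by blast
    have "(\<lambda>x. g S x - g T x) = (\<lambda>x. \<Sum>j=1..k. (s S j - s T j) * e j x)"
      by (simp add: g_def sum_subtractf left_diff_distrib)
    then show "TC_norm X d (\<lambda>x. g S x - g T x) = 2"
      using j by (simp only: norm) (rule linf_norm_eqI[OF j(1)], auto simp: s_def)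
  qed (rule v)
  ultimately have "2 ^ (k - 1) \<le> 2 * canonical_degree X d v"
    using i by (simp add: I_def)
  then have "2 ^ (k - 1) \<le> 2 * real (canonical_degree X d v)"
    by (metis of_nat_le_iff of_nat_mult of_nat_numeral of_nat_power)
  moreover have "2 powi (int k - 2) = (2 :: real) ^ (k - 1) / 2"
    using i by (cases k) (auto simp: power_int_diff power_int_add)
  ultimately show ?thesis by simp
qed

end

section \<open>Subspaces isometric to the sup-norm space\<close>

lemma TC_two_support_points:
  assumes "finite X" and "f \<in> TC X" and "f \<noteq> (\<lambda>_. 0)"
  shows "\<exists>u\<in>X. \<exists>v\<in>X. u \<noteq> v \<and> f u \<noteq> 0 \<and> f v \<noteq> 0"
proof -
  have out: "f x = 0" if "x \<notin> X" for x using assms(2) that by (simp add: TC_def)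
  obtain u where u: "f u \<noteq> 0" using assms(3) by (auto simp: fun_eq_iff)
  then have uX: "u \<in> X" using out by blast
  have "f u + (\<Sum>x\<in>X - {u}. f x) = 0"
    using assms(1,2) uX by (simp add: TC_def sum.remove[of X u])
  then have "(\<Sum>x\<in>X - {u}. f x) \<noteq> 0" using u by linarith
  then obtain v where "v \<in> X - {u}" "f v \<noteq> 0" by (meson sum.neutral)
  then show ?thesis using u uX by blast
qed

lemma isometric_imp_equiv_linf_basis:
  assumes "isometric_to_linf X d k L"
  shows "\<exists>e. (\<forall>i\<in>{1..k}. e i \<in> L) \<and> equiv_linf_basis X d k e"
proof -
  obtain T where lin: "Vector_Spaces.linear fun_scale fun_scale T"
    and bij: "bij_betw T (linf_space k) L"
    and norm: "\<And>a. a \<in> linf_space k \<Longrightarrow> TC_norm X d (T a) = linf_norm k a"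
    using assms unfolding isometric_to_linf_def by blast
  interpret T: Vector_Spaces.linear fun_scale fun_scale T by (rule lin)
  define b :: "nat \<Rightarrow> nat \<Rightarrow> real" where "b i j = (if j = i then 1 else 0)" for i j
  have "\<forall>i\<in>{1..k}. T (b i) \<in> L"
    using bij_betwE[OF bij] by (auto simp: linf_space_def b_def)
  moreover have "equiv_linf_basis X d k (\<lambda>i. T (b i))"
    unfolding equiv_linf_basis_def
  proof
    fix a :: "nat \<Rightarrow> real"
    define a' where "a' j = (if j \<in> {1..k} then a j else 0)" for j
    have "(\<Sum>i=1..k. fun_scale (a i) (b i)) = a'"
      by (auto simp: fun_eq_iff sum_fun_apply fun_scale_def b_def a'_def if_distrib cong: if_cong)
    then have "(\<Sum>i=1..k. fun_scale (a i) (T (b i))) = T a'"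
      by (metis (no_types, lifting) T.scale T.sum sum.cong)
    moreover have "a' \<in> linf_space k" by (auto simp: linf_space_def a'_def)
    moreover have "linf_norm k a' = linf_norm k a"
      unfolding linf_norm_def a'_def by (intro arg_cong[of _ _ Max] image_cong) auto
    ultimately show "TC_norm X d (\<Sum>i=1..k. fun_scale (a i) (T (b i))) = linf_norm k a"
      using norm by simp
  qed
  ultimately show ?thesis
    by (intro exI[of _ "\<lambda>i. T (b i)"] conjI)
qed

lemma equiv_linf_basis_nonzero:
  assumes "equiv_linf_basis X d k e" and "i \<in> {1..k}"
  shows "e i \<noteq> (\<lambda>_. 0)"
proof
  assume z: "e i = (\<lambda>_. 0)"
  define a :: "nat \<Rightarrow> real" where "a j = (if j = i then 1 else 0)" for j
  have "(\<Sum>j=1..k. fun_scale (a j) (e j)) = (\<Sum>j=1..k. fun_scale 0 (e j))"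
    using z by (intro sum.cong) (auto simp: a_def fun_scale_def)
  then have "linf_norm k a = linf_norm k (\<lambda>_. 0)"
    using assms(1)[unfolded equiv_linf_basis_def, rule_format, of a]
      assms(1)[unfolded equiv_linf_basis_def, rule_format, of "\<lambda>_. 0"] by metis
  moreover have "linf_norm k a = 1" "linf_norm k (\<lambda>_. 0) = 0"
    by (auto intro!: linf_norm_eqI[OF assms(2)] simp: a_def)
  ultimately show False by simp
qed

theorem theorem3p4:
  fixes X :: "'a set" and d :: "'a \<Rightarrow> 'a \<Rightarrow> real" and k :: nat
  assumes "Metric_space X d" and "finite X" and "k \<ge> 1"
  shows "((\<exists>L. fun_vs.subspace L \<and> L \<subseteq> TC X \<and> isometric_to_linf X d k L) \<longrightarrow>
            (\<exists>u\<in>X. \<exists>v\<in>X. u \<noteq> v \<and>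
               real (canonical_degree X d u) \<ge> 2 powi (int k - 2) \<and>
               real (canonical_degree X d v) \<ge> 2 powi (int k - 2))) \<and>
         (\<forall>e :: nat \<Rightarrow> 'a \<Rightarrow> real.
            (\<forall>i\<in>{1..k}. e i \<in> TC X) \<and> equiv_linf_basis X d k e \<longrightarrow>
            (\<forall>i\<in>{1..k}. \<forall>v\<in>{x\<in>X. e i x \<noteq> 0}.
               real (canonical_degree X d v) \<ge> 2 powi (int k - 2)))"
proof (intro conjI impI)
  interpret finite_metric X d
    by (intro finite_metric.intro finite_metric_axioms.intro assms)
  show basis: "\<forall>e :: nat \<Rightarrow> 'a \<Rightarrow> real.
            (\<forall>i\<in>{1..k}. e i \<in> TC X) \<and> equiv_linf_basis X d k e \<longrightarrow>
            (\<forall>i\<in>{1..k}. \<forall>v\<in>{x\<in>X. e i x \<noteq> 0}.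
               real (canonical_degree X d v) \<ge> 2 powi (int k - 2))"
    using support_degree by blast
  assume "\<exists>L. fun_vs.subspace L \<and> L \<subseteq> TC X \<and> isometric_to_linf X d k L"
  then obtain e where e: "\<forall>i\<in>{1..k}. e i \<in> TC X" "equiv_linf_basis X d k e"
    using isometric_imp_equiv_linf_basis by (metis subsetD)
  have one: "1 \<in> {1..k}" using assms(3) by simp
  have "e 1 \<in> TC X" and "e 1 \<noteq> (\<lambda>_. 0)"
    using e(1) one equiv_linf_basis_nonzero[OF e(2) one] by auto
  then obtain u v where uv: "u \<in> X" "v \<in> X" "u \<noteq> v" "e 1 u \<noteq> 0" "e 1 v \<noteq> 0"
    using TC_two_support_points[OF assms(2)] by meson
  have "2 powi (int k - 2) \<le> real (canonical_degree X d w)" if "w \<in> X" "e 1 w \<noteq> 0" for w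
    using support_degree[OF bspec[OF e(1)] e(2) one that] .
  with uv show "\<exists>u\<in>X. \<exists>v\<in>X. u \<noteq> v \<and>
               real (canonical_degree X d u) \<ge> 2 powi (int k - 2) \<and>
               real (canonical_degree X d v) \<ge> 2 powi (int k - 2)"
    by meson
qed

end
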